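(* Let $d,n\ge 1$ be integers and let $K\subset\mathbb{R}^d$ be a $0$-symmetric convex body. For every integer $k\ge 1$, \[ U(K)\le 2V(K), \] where $U(K)$ and $V(K)$ are the constants, defined in the context, associated with $k\times n$ matrices with entries in $K$.
   Context: A $0$-symmetric convex body in $\mathbb{R}^d$ is a compact convex set $K$ with non-empty interior and $K=-K$; it defines the norm $\|x\|=\min\{t\ge 0: x\in tK\}$ on $\mathbb{R}^d$. The integers $d,k,n\ge 1$ are fixed (the constants $U(K)$ and $V(K)$ below depend on $k$ and $n$ as well as on $K$, and the same $k,n$ are used for both). Let $\mathcal{A}(K)$ be the set of $k\times n$ matrices $A=\{a_i^j\}$ (row index $j\in\{1,\ldots,k\}$, column index $i\in\{1,\ldots,n\}$) with entries $a_i^j\in K$. For a $k\times n$ matrix $A=\{a_i^j\}$ with entries in $\mathbb{R}^d$ and $m\in\{1,\ldots,n\}$, let $\sigma_m(A)=\sum_{j=1}^k\sum_{i=1}^m a_i^j$ be the sum of the entries in the first $m$ columns. A row-permuted copy of $A$ is a $k\times n$ matrix $C=\{c_i^j\}$ such that for every $j$ the sequence $c_1^j,\ldots,c_n^j$ is a rearrangement of $a_1^j,\ldots,a_n^j$ (the permutation may be different in different rows). For $A\in\mathcal{A}(K)$ with $\sigma_n(A)=0$ set $U(A)=\min_C\max_{1\le m\le n}\|\sigma_m(C)\|$, where the minimum is over all row-permuted copies $C$ of $A$, and set \[ U(K)=\max\{U(A): A\in\mathcal{A}(K),\ \sigma_n(A)=0\} \] (the maximum exists by compactness). For $B=\{b_i^j\}\in\mathcal{A}(K)$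 and a $k\times n$ matrix $\varepsilon=\{\varepsilon_i^j\}$ with $\varepsilon_i^j\in\{-1,1\}$, write $B^{\varepsilon}=\{\varepsilon_i^j b_i^j\}$; set $V(B)=\min_{\varepsilon}\max_{1\le m\le n}\|\sigma_m(B^{\varepsilon})\|$, where the minimum is over all such sign matrices $\varepsilon$, and set \[ V(K)=\max\{V(B): B\in\mathcal{A}(K)\}. \] *)

theory Defs
  imports "HOL-Analysis.Analysis"
begin

definition symmetric_convex_body :: "'a::euclidean_space set \<Rightarrow> bool" where
  "symmetric_convex_body K \<longleftrightarrow>
     compact K \<and> convex K \<and> interior K \<noteq> {} \<and> K = uminus ` K"

text \<open>The infimum below is a minimum for every symmetric convex body,
  see \<open>body_norm_attained\<close>.\<close>

definition body_norm :: "'a::euclidean_space set \<Rightarrow> 'a \<Rightarrow> real" where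
  "body_norm K x = Inf {t. 0 \<le> t \<and> x \<in> (\<lambda>y. t *\<^sub>R y) ` K}"

text \<open>\<open>A j i\<close> is the entry in row \<open>j\<close> and column \<open>i\<close>; matrices are extensional functions
  (\<open>undefined\<close> outside the index range), so that finite entry sets give finitely many matrices.\<close>

definition matrices :: "nat \<Rightarrow> nat \<Rightarrow> 'a set \<Rightarrow> (nat \<Rightarrow> nat \<Rightarrow> 'a) set" where
  "matrices k n S = {1..k} \<rightarrow>\<^sub>E ({1..n} \<rightarrow>\<^sub>E S)"

definition column_sum :: "nat \<Rightarrow> nat \<Rightarrow> (nat \<Rightarrow> nat \<Rightarrow> 'a::real_vector) \<Rightarrow> 'a" where
  "column_sum k m A = (\<Sum>j=1..k. \<Sum>i=1..m. A j i)"

definition max_partial_norm ::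
  "nat \<Rightarrow> nat \<Rightarrow> 'a::euclidean_space set \<Rightarrow> (nat \<Rightarrow> nat \<Rightarrow> 'a) \<Rightarrow> real" where
  "max_partial_norm k n K A = Max ((\<lambda>m. body_norm K (column_sum k m A)) ` {1..n})"

definition row_permuted_copies ::
  "nat \<Rightarrow> nat \<Rightarrow> (nat \<Rightarrow> nat \<Rightarrow> 'a) \<Rightarrow> (nat \<Rightarrow> nat \<Rightarrow> 'a) set" where
  "row_permuted_copies k n A =
     {C \<in> matrices k n UNIV.
        \<forall>j\<in>{1..k}. \<exists>p. p permutes {1..n} \<and> (\<forall>i\<in>{1..n}. C j i = A j (p i))}"

definition U_matrix ::
  "nat \<Rightarrow> nat \<Rightarrow> 'a::euclidean_space set \<Rightarrow> (nat \<Rightarrow> nat \<Rightarrow> 'a) \<Rightarrow> real" where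
  "U_matrix k n K A = Min (max_partial_norm k n K ` row_permuted_copies k n A)"

definition signed_matrix ::
  "nat \<Rightarrow> nat \<Rightarrow> (nat \<Rightarrow> nat \<Rightarrow> real) \<Rightarrow> (nat \<Rightarrow> nat \<Rightarrow> 'a::real_vector)
    \<Rightarrow> (nat \<Rightarrow> nat \<Rightarrow> 'a)" where
  "signed_matrix k n \<epsilon> B = (\<lambda>j\<in>{1..k}. \<lambda>i\<in>{1..n}. \<epsilon> j i *\<^sub>R B j i)"

definition V_matrix ::
  "nat \<Rightarrow> nat \<Rightarrow> 'a::euclidean_space set \<Rightarrow> (nat \<Rightarrow> nat \<Rightarrow> 'a) \<Rightarrow> real" where
  "V_matrix k n K B =
     Min ((\<lambda>\<epsilon>. max_partial_norm k n K (signed_matrix k n \<epsilon> B)) ` matrices k n {-1, 1})"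

text \<open>The following two suprema are maxima for every symmetric convex body and \<open>n \<ge> 1\<close>,
  see \<open>U_body_attained\<close> and \<open>V_body_attained\<close>.\<close>

definition U_body :: "nat \<Rightarrow> nat \<Rightarrow> 'a::euclidean_space set \<Rightarrow> real" where
  "U_body k n K = Sup (U_matrix k n K ` {A \<in> matrices k n K. column_sum k n A = 0})"

definition V_body :: "nat \<Rightarrow> nat \<Rightarrow> 'a::euclidean_space set \<Rightarrow> real" where
  "V_body k n K = Sup (V_matrix k n K ` matrices k n K)"

lemma symmetric_convex_body_cball:
  assumes "symmetric_convex_body K"
  obtains r where "r > 0" "cball 0 r \<subseteq> K"
proof -
  from assms obtain x where x: "x \<in> interior K"
    by (auto simp: symmetric_convex_body_def)
  have "- x \<in> interior (uminus ` K)"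
    using x by (simp add: interior_negations)
  then have "- x \<in> interior K"
    using assms by (metis symmetric_convex_body_def)
  moreover have "convex (interior K)"
    using assms by (simp add: symmetric_convex_body_def convex_interior)
  ultimately have "(1/2) *\<^sub>R x + (1/2) *\<^sub>R (- x) \<in> interior K"
    using x by (intro convexD) auto
  then have "0 \<in> interior K" by simp
  then show thesis
    using that by (meson mem_interior_cball)
qed

lemma body_norm_attained:
  assumes K: "symmetric_convex_body K"
  shows "0 \<le> body_norm K x \<and> x \<in> (\<lambda>y. body_norm K x *\<^sub>R y) ` K"
    and "0 \<le> t \<Longrightarrow> x \<in> (\<lambda>y. t *\<^sub>R y) ` K \<Longrightarrow> body_norm K x \<le> t"
proof -
  let ?T = "{t. 0 \<le> t \<and> x \<in> (\<lambda>y. t *\<^sub>R y) ` K}"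
  obtain r where r: "r > 0" "cball 0 r \<subseteq> K"
    using K by (rule symmetric_convex_body_cball)
  have nonempty: "norm x / r \<in> ?T"
  proof (cases "x = 0")
    case True
    moreover have "0 \<in> K" using r by auto
    ultimately show ?thesis using r by (simp add: image_eqI[where x = 0])
  next
    case False
    then have "(r / norm x) *\<^sub>R x \<in> K"
      using r by (auto intro!: subsetD[OF r(2)])
    moreover have "x = (norm x / r) *\<^sub>R (r / norm x) *\<^sub>R x"
      using False r(1) by simp
    ultimately have "x \<in> (\<lambda>y. (norm x / r) *\<^sub>R y) ` K" by (rule rev_image_eqI)
    then show ?thesis using r(1) by simp
  qed
  define S where "S = fst ` (({0..norm x / r} \<times> K) \<inter> {z. fst z *\<^sub>R snd z = x})"
  have "closed {z. fst z *\<^sub>R snd z = x}"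
    by (intro closed_Collect_eq continuous_on_scaleR continuous_on_fst continuous_on_snd
        continuous_on_id continuous_on_const)
  moreover have "compact ({0..norm x / r} \<times> K)"
    using K unfolding symmetric_convex_body_def by (intro compact_Times compact_Icc) auto
  ultimately have "compact S"
    unfolding S_def
    by (intro compact_continuous_image compact_Int_closed continuous_on_fst continuous_on_id)
  have S_iff: "t \<in> S \<longleftrightarrow> t \<in> ?T \<and> t \<le> norm x / r" for t
  proof
    assume "t \<in> S"
    then show "t \<in> ?T \<and> t \<le> norm x / r" unfolding S_def by auto
  next
    assume t: "t \<in> ?T \<and> t \<le> norm x / r"
    then obtain y where "y \<in> K" "t *\<^sub>R y = x" by blast
    with t have "(t, y) \<in> ({0..norm x / r} \<times> K) \<inter> {z. fst z *\<^sub>R snd z = x}" by simp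
    then show "t \<in> S" unfolding S_def by (rule rev_image_eqI) simp
  qed
  have "S \<noteq> {}" using nonempty S_iff by blast
  with \<open>compact S\<close> obtain s where s: "s \<in> S" "\<And>t. t \<in> S \<Longrightarrow> s \<le> t"
    by (meson compact_attains_inf)
  have s_T: "s \<in> ?T" and s_le: "s \<le> norm x / r"
    using s(1) S_iff by blast+
  have s_least: "s \<le> t" if "t \<in> ?T" for t
  proof (cases "t \<le> norm x / r")
    case True
    then show ?thesis using s(2) S_iff that by blast
  next
    case False
    then show ?thesis using s_le by linarith
  qed
  have "body_norm K x = s"
    unfolding body_norm_def using s_T s_least by (rule cInf_eq_minimum)
  then show "0 \<le> body_norm K x \<and> x \<in> (\<lambda>y. body_norm K x *\<^sub>R y) ` K"
    and "0 \<le> t \<Longrightarrow> x \<in> (\<lambda>y. t *\<^sub>R y) ` K \<Longrightarrow> body_norm K x \<le> t"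
    using s_T s_least by simp_all
qed

lemma body_norm_triangle:
  assumes K: "symmetric_convex_body K"
  shows "body_norm K (x + y) \<le> body_norm K x + body_norm K y"
proof -
  let ?s = "body_norm K x" and ?t = "body_norm K y"
  obtain a b where a: "a \<in> K" "x = ?s *\<^sub>R a" and b: "b \<in> K" "y = ?t *\<^sub>R b"
    using body_norm_attained(1)[OF K] by blast
  have nn: "?s \<ge> 0" "?t \<ge> 0" using body_norm_attained(1)[OF K] by auto
  have "x + y \<in> (\<lambda>z. (?s + ?t) *\<^sub>R z) ` K"
  proof (cases "?s + ?t = 0")
    case True
    with nn have "?s = 0" "?t = 0" by auto
    with a b have "x + y = 0" by simp
    then show ?thesis using True a(1) by auto
  next
    case False
    let ?c = "(?s / (?s + ?t)) *\<^sub>R a + (?t / (?s + ?t)) *\<^sub>R b"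
    have "?c \<in> K"
      using K a(1) b(1) nn False unfolding symmetric_convex_body_def
      by (intro convexD) (auto simp: add_divide_distrib[symmetric])
    moreover have "x + y = (?s + ?t) *\<^sub>R ?c"
      using False a(2) b(2) by (simp add: scaleR_add_right)
    ultimately show ?thesis by blast
  qed
  then show ?thesis using nn by (intro body_norm_attained(2)[OF K]) auto
qed

lemma body_norm_scaleR_le:
  assumes K: "symmetric_convex_body K" and "c \<ge> 0"
  shows "body_norm K (c *\<^sub>R x) \<le> c * body_norm K x"
proof -
  obtain a where a: "a \<in> K" "x = body_norm K x *\<^sub>R a"
    using body_norm_attained(1)[OF K] by blast
  have "c *\<^sub>R x = (c * body_norm K x) *\<^sub>R a" using a(2) by (metis scaleR_scaleR)
  then show ?thesis
    using a(1) assms body_norm_attained(1)[OF K] by (intro body_norm_attained(2)[OF K]) auto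
qed

lemma continuous_on_body_norm:
  assumes K: "symmetric_convex_body K"
  shows "continuous_on UNIV (body_norm K)"
proof (rule convex_on_continuous)
  show "convex_on UNIV (body_norm K)"
  proof (rule convex_onI)
    fix t :: real and x y :: 'a
    assume "0 < t" "t < 1"
    then show "body_norm K ((1 - t) *\<^sub>R x + t *\<^sub>R y) \<le> (1 - t) * body_norm K x + t * body_norm K y"
      using body_norm_triangle[OF K, of "(1 - t) *\<^sub>R x" "t *\<^sub>R y"]
        body_norm_scaleR_le[OF K, of "1 - t" x] body_norm_scaleR_le[OF K, of t y] by auto
  qed auto
qed auto

lemma continuous_on_Max_image:
  fixes f :: "'b \<Rightarrow> 'a::topological_space \<Rightarrow> real"
  assumes "finite I" "I \<noteq> {}" "\<And>i. i \<in> I \<Longrightarrow> continuous_on S (f i)"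
  shows "continuous_on S (\<lambda>x. Max ((\<lambda>i. f i x) ` I))"
  using assms by (induction rule: finite_ne_induct) (auto intro!: continuous_on_max)

lemma continuous_on_Min_image:
  fixes f :: "'b \<Rightarrow> 'a::topological_space \<Rightarrow> real"
  assumes "finite I" "I \<noteq> {}" "\<And>i. i \<in> I \<Longrightarrow> continuous_on S (f i)"
  shows "continuous_on S (\<lambda>x. Min ((\<lambda>i. f i x) ` I))"
  using assms by (induction rule: finite_ne_induct) (auto intro!: continuous_on_min)

lemma finite_matrices: "finite S \<Longrightarrow> finite (matrices k n S)"
  by (simp add: matrices_def finite_PiE)

lemma compact_PiE_nat:
  fixes S :: "nat \<Rightarrow> 'a::topological_space set"
  assumes "\<And>i. i \<in> I \<Longrightarrow> compact (S i)"
  shows "compact (PiE I S)"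
proof -
  have "PiE I S = PiE UNIV (\<lambda>i. if i \<in> I then S i else {undefined})"
    by (auto simp: PiE_def Pi_def extensional_def split: if_splits)
  moreover have "compactin (product_topology (\<lambda>i. euclidean) UNIV)
      (PiE UNIV (\<lambda>i. if i \<in> I then S i else {undefined}))"
    using assms by (simp add: compactin_PiE)
  ultimately show ?thesis
    by (simp add: euclidean_product_topology)
qed

lemma compact_matrices: "compact S \<Longrightarrow> compact (matrices k n S)"
  unfolding matrices_def by (intro compact_PiE_nat)

lemma continuous_on_entry:
  "continuous_on X (\<lambda>A::nat \<Rightarrow> nat \<Rightarrow> 'a::topological_space. A j i)"
  by (rule continuous_on_product_then_coordinatewise
      [OF continuous_on_product_then_coordinatewise[OF continuous_on_id]])

lemma continuous_on_max_partial_norm: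
  fixes F :: "(nat \<Rightarrow> nat \<Rightarrow> 'a::euclidean_space) \<Rightarrow> (nat \<Rightarrow> nat \<Rightarrow> 'a)"
  assumes K: "symmetric_convex_body K" and n: "n \<ge> 1"
    and F: "\<And>j i. j \<in> {1..k} \<Longrightarrow> i \<in> {1..n} \<Longrightarrow> continuous_on S (\<lambda>A. F A j i)"
  shows "continuous_on S (\<lambda>A. max_partial_norm k n K (F A))"
  unfolding max_partial_norm_def column_sum_def
  using n by (intro continuous_on_Max_image
    continuous_on_compose2[OF continuous_on_body_norm[OF K]] continuous_on_sum F) auto

lemma row_permuted_copies_eq:
  "row_permuted_copies k n A =
     (\<lambda>\<pi>. \<lambda>j\<in>{1..k}. \<lambda>i\<in>{1..n}. A j (\<pi> j i)) ` ({1..k} \<rightarrow>\<^sub>E {p. p permutes {1..n}})"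
  (is "_ = ?R")
proof
  show "?R \<subseteq> row_permuted_copies k n A"
    unfolding row_permuted_copies_def matrices_def by fastforce
next
  show "row_permuted_copies k n A \<subseteq> ?R"
  proof
    fix C assume "C \<in> row_permuted_copies k n A"
    then have C: "C \<in> matrices k n UNIV"
      and "\<forall>j\<in>{1..k}. \<exists>p. p permutes {1..n} \<and> (\<forall>i\<in>{1..n}. C j i = A j (p i))"
      by (auto simp: row_permuted_copies_def)
    then obtain p where p: "\<And>j. j \<in> {1..k} \<Longrightarrow> p j permutes {1..n}"
      "\<And>i j. j \<in> {1..k} \<Longrightarrow> i \<in> {1..n} \<Longrightarrow> C j i = A j (p j i)"
      by metis
    have "C j i = (\<lambda>j\<in>{1..k}. \<lambda>i\<in>{1..n}. A j (restrict p {1..k} j i)) j i" for j i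
      using C p(2) unfolding matrices_def
      by (cases "j \<in> {1..k}"; cases "i \<in> {1..n}") (auto simp: PiE_def extensional_def Pi_def)
    then have "C = (\<lambda>j\<in>{1..k}. \<lambda>i\<in>{1..n}. A j (restrict p {1..k} j i))"
      by blast
    moreover have "restrict p {1..k} \<in> {1..k} \<rightarrow>\<^sub>E {p. p permutes {1..n}}"
      using p(1) by auto
    ultimately show "C \<in> ?R" by (rule image_eqI)
  qed
qed

lemma row_perms_finite:
  "finite ({1..k::nat} \<rightarrow>\<^sub>E {p. p permutes {1..n::nat}})"
  "({1..k::nat} \<rightarrow>\<^sub>E {p. p permutes {1..n::nat}}) \<noteq> {}"
proof -
  show "finite ({1..k::nat} \<rightarrow>\<^sub>E {p. p permutes {1..n::nat}})"
    by (intro finite_PiE finite_permutations) auto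
  show "({1..k::nat} \<rightarrow>\<^sub>E {p. p permutes {1..n::nat}}) \<noteq> {}"
    using permutes_id[of "{1..n}"] by (simp only: PiE_eq_empty_iff) blast
qed

lemma finite_row_permuted_copies:
  "finite (row_permuted_copies k n A)" "row_permuted_copies k n A \<noteq> {}"
  unfolding row_permuted_copies_eq image_is_empty
  by (intro finite_imageI row_perms_finite)+

lemma continuous_on_U_matrix:
  assumes K: "symmetric_convex_body K" and n: "n \<ge> 1"
  shows "continuous_on S (U_matrix k n K)"
proof -
  have entries: "continuous_on S (\<lambda>A::nat \<Rightarrow> nat \<Rightarrow> 'a. (\<lambda>j\<in>{1..k}. \<lambda>i\<in>{1..n}. A j (\<pi> j i)) j i)"
    if "j \<in> {1..k}" "i \<in> {1..n}" for \<pi> j i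
    unfolding restrict_apply if_P[OF that(1)] if_P[OF that(2)] by (rule continuous_on_entry)
  show ?thesis
    unfolding U_matrix_def[abs_def] row_permuted_copies_eq image_image
    by (rule continuous_on_Min_image[OF row_perms_finite])
      (rule continuous_on_max_partial_norm[OF K n entries])
qed

lemma continuous_on_V_matrix:
  assumes K: "symmetric_convex_body K" and n: "n \<ge> 1"
  shows "continuous_on S (V_matrix k n K)"
proof -
  have fin: "finite {-1, 1::real}" by simp
  have nonempty: "matrices k n {-1, 1::real} \<noteq> {}"
    by (simp add: matrices_def PiE_eq_empty_iff)
  have entries: "continuous_on S (\<lambda>B::nat \<Rightarrow> nat \<Rightarrow> 'a. signed_matrix k n \<epsilon> B j i)"
    if "j \<in> {1..k}" "i \<in> {1..n}" for \<epsilon> j i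
    unfolding signed_matrix_def restrict_apply if_P[OF that(1)] if_P[OF that(2)]
    by (rule continuous_on_scaleR[OF continuous_on_const continuous_on_entry])
  show ?thesis
    unfolding V_matrix_def[abs_def]
    by (rule continuous_on_Min_image[OF finite_matrices[OF fin] nonempty])
      (rule continuous_on_max_partial_norm[OF K n entries])
qed

lemma zero_matrix:
  assumes "symmetric_convex_body K"
  shows "(\<lambda>j\<in>{1..k}. \<lambda>i\<in>{1..n}. 0) \<in> {A \<in> matrices k n K. column_sum k n A = 0}"
proof -
  obtain r where "r > 0" "cball 0 r \<subseteq> K"
    using assms by (rule symmetric_convex_body_cball)
  then have "0 \<in> K" by auto
  then show ?thesis by (auto simp: matrices_def column_sum_def)
qed

lemma Sup_image_attained:
  fixes f :: "'a::topological_space \<Rightarrow> real"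
  assumes "compact S" "S \<noteq> {}" "continuous_on S f"
  shows "\<exists>x\<in>S. f x = Sup (f ` S) \<and> (\<forall>y\<in>S. f y \<le> Sup (f ` S))"
proof -
  obtain x where x: "x \<in> S" "\<And>y. y \<in> S \<Longrightarrow> f y \<le> f x"
    using continuous_attains_sup[OF assms] by blast
  then have "Sup (f ` S) = f x" by (intro cSup_eq_maximum) auto
  with x show ?thesis by auto
qed

lemma U_body_attained:
  fixes K :: "'a::euclidean_space set"
  assumes K: "symmetric_convex_body K" and n: "n \<ge> 1"
  shows "\<exists>A\<in>{A \<in> matrices k n K. column_sum k n A = 0}. U_matrix k n K A = U_body k n K \<and>
    (\<forall>A'\<in>{A \<in> matrices k n K. column_sum k n A = 0}. U_matrix k n K A' \<le> U_body k n K)"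
  unfolding U_body_def
proof (rule Sup_image_attained)
  have "continuous_on UNIV (column_sum k n :: (nat \<Rightarrow> nat \<Rightarrow> 'a) \<Rightarrow> 'a)"
    unfolding column_sum_def[abs_def] by (intro continuous_on_sum continuous_on_entry)
  then have "closed {A :: nat \<Rightarrow> nat \<Rightarrow> 'a. column_sum k n A = 0}"
    by (rule closed_Collect_eq[OF _ continuous_on_const])
  moreover have "compact (matrices k n K)"
    using K by (simp add: symmetric_convex_body_def compact_matrices)
  ultimately have "compact (matrices k n K \<inter> {A. column_sum k n A = 0})"
    by (metis compact_Int_closed)
  then show "compact {A \<in> matrices k n K. column_sum k n A = 0}"
    by (simp add: Collect_conj_eq)
  show "{A \<in> matrices k n K. column_sum k n A = 0} \<noteq> {}"
    using zero_matrix[OF K] by blast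
qed (rule continuous_on_U_matrix[OF K n])

lemma V_body_attained:
  fixes K :: "'a::euclidean_space set"
  assumes K: "symmetric_convex_body K" and n: "n \<ge> 1"
  shows "\<exists>B\<in>matrices k n K. V_matrix k n K B = V_body k n K \<and>
    (\<forall>B'\<in>matrices k n K. V_matrix k n K B' \<le> V_body k n K)"
  unfolding V_body_def
proof (rule Sup_image_attained)
  show "compact (matrices k n K)"
    using K by (simp add: symmetric_convex_body_def compact_matrices)
  show "matrices k n K \<noteq> {}" using zero_matrix[OF K] by blast
qed (rule continuous_on_V_matrix[OF K n])

end

theory Submission
  imports Defs
begin

text \<open>
  The theorem is a transference argument in the manner of Chobanyan, adapted to several rows.
  Let \<open>C\<close> be an optimal row-permuted copy of a zero-sum matrix \<open>A\<close>, with value \<open>u = U(A)\<close>.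
  Splitting a row into its positively and negatively signed entries would not work here, since
  different rows would have different numbers of positive entries, and a prefix of columns would
  no longer correspond to a common prefix of \<open>C\<close>.
  The remedy is to put signs on pairs: in every row, columns \<open>2i-1\<close> and \<open>2i\<close> of \<open>C\<close>
  are paired, and the signs are chosen well for the half differences
  \<open>b\<^sub>i = (c\<^sub>2\<^sub>i\<^sub>-\<^sub>1 - c\<^sub>2\<^sub>i) / 2\<close>, which lie in \<open>K\<close> again.
  A sign says which member of the pair moves to column \<open>i\<close>; the other member moves to
  column \<open>n+1-i\<close> (for odd \<open>n\<close> the unpaired column goes to the middle).

  The members placed in columns \<open>i\<close> and \<open>n+1-i\<close> are the average of the pair plus and minus
  \<open>\<epsilon>\<^sub>i b\<^sub>i\<close>. Hence for \<open>m \<le> n div 2\<close> the sum of the first \<open>m\<close> columns of the new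
  matrix is \<open>\<sigma>\<^sub>2\<^sub>m(C) / 2\<close> plus the signed sum of the half differences with \<open>i \<le> m\<close>, the sum of
  its last \<open>m\<close> columns is \<open>\<sigma>\<^sub>2\<^sub>m(C) / 2\<close> minus the same signed sum, and both have norm at most
  \<open>u / 2 + V(K)\<close>. Since all entries sum to zero, a longer initial sum is minus such
  a final sum (lemma \<open>column_sum_fold_bound\<close>). The new matrix is another
  row-permuted copy of \<open>A\<close>, so \<open>u \<le> u / 2 + V(K)\<close>, that is \<open>u \<le> 2 V(K)\<close>.
\<close>

section \<open>The norm of a symmetric convex body\<close>

lemma symmetric_convex_body_uminus:
  assumes "symmetric_convex_body K" "x \<in> K"
  shows "- x \<in> K"
  using assms unfolding symmetric_convex_body_def by (metis image_eqI)

lemma symmetric_convex_body_zero: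
  assumes "symmetric_convex_body K"
  shows "0 \<in> K"
  using assms by (rule symmetric_convex_body_cball) auto

lemma symmetric_convex_body_half_diff:
  assumes K: "symmetric_convex_body K" and "x \<in> K" "y \<in> K"
  shows "(1/2) *\<^sub>R (x - y) \<in> K"
proof -
  have "(1/2) *\<^sub>R x + (1/2) *\<^sub>R (- y) \<in> K"
    using assms symmetric_convex_body_uminus[OF K, of y]
    unfolding symmetric_convex_body_def by (intro convexD) auto
  then show ?thesis by (simp add: scaleR_diff_right)
qed

lemma body_norm_nonneg: "symmetric_convex_body K \<Longrightarrow> 0 \<le> body_norm K x"
  using body_norm_attained(1) by blast

lemma body_norm_zero:
  assumes K: "symmetric_convex_body K"
  shows "body_norm K 0 = 0"
  using body_norm_scaleR_le[OF K, of 0 0] body_norm_nonneg[OF K, of 0] by simp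

lemma body_norm_minus_le:
  assumes K: "symmetric_convex_body K"
  shows "body_norm K (- x) \<le> body_norm K x"
proof -
  obtain a where a: "a \<in> K" "x = body_norm K x *\<^sub>R a"
    using body_norm_attained(1)[OF K] by blast
  have "- x = body_norm K x *\<^sub>R (- a)" using a(2) by (metis scaleR_minus_right)
  then have "- x \<in> (\<lambda>y. body_norm K x *\<^sub>R y) ` K"
    using symmetric_convex_body_uminus[OF K a(1)] by (rule image_eqI)
  with body_norm_nonneg[OF K] show ?thesis by (rule body_norm_attained(2)[OF K])
qed

lemma body_norm_minus:
  assumes K: "symmetric_convex_body K"
  shows "body_norm K (- x) = body_norm K x"
  using body_norm_minus_le[OF K, of x] body_norm_minus_le[OF K, of "- x"] by simp

lemma body_norm_half_plus_le:
  assumes K: "symmetric_convex_body K"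
  shows "body_norm K ((1/2) *\<^sub>R x + y) \<le> body_norm K x / 2 + body_norm K y"
  using body_norm_triangle[OF K, of "(1/2) *\<^sub>R x" y] body_norm_scaleR_le[OF K, of "1/2" x] by simp

lemma body_norm_column_sum_le:
  assumes K: "symmetric_convex_body K" and "1 \<le> n" "m \<le> n"
  shows "body_norm K (column_sum k m A) \<le> max_partial_norm k n K A"
proof -
  have *: "body_norm K (column_sum k l A) \<le> max_partial_norm k n K A" if "l \<in> {1..n}" for l
    unfolding max_partial_norm_def using that by (intro Max_ge) auto
  show ?thesis
  proof (cases "m = 0")
    case True
    then have "body_norm K (column_sum k m A) = 0"
      by (simp add: column_sum_def body_norm_zero[OF K])
    also have "\<dots> \<le> body_norm K (column_sum k 1 A)" by (rule body_norm_nonneg[OF K])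
    also have "\<dots> \<le> max_partial_norm k n K A" using assms by (intro *) auto
    finally show ?thesis .
  qed (use assms in \<open>auto intro: *\<close>)
qed

section \<open>Folding a row\<close>

text \<open>Position \<open>i\<close> of the folded row receives the entry at place \<open>pair_fold n s i\<close>: the
  selected member of the \<open>i\<close>-th pair \<open>{2i-1, 2i}\<close> in the left half, the rejected member of
  the \<open>(n+1-i)\<close>-th pair in the right half, and the unpaired last place in the middle when \<open>n\<close>
  is odd. Outside \<open>{1..n}\<close> it is the identity, so that it can be a permutation of \<open>{1..n}\<close>.\<close>

definition pair_fold :: "nat \<Rightarrow> (nat \<Rightarrow> bool) \<Rightarrow> nat \<Rightarrow> nat" where
  "pair_fold n s i =
    (if 1 \<le> i \<and> i \<le> n div 2 then (if s i then 2 * i - 1 else 2 * i)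
     else if i \<le> n \<and> n + 1 - i \<le> n div 2
       then (if s (n + 1 - i) then 2 * (n + 1 - i) else 2 * (n + 1 - i) - 1)
     else if i \<le> n \<and> i = n div 2 + 1 then n
     else i)"

lemma pair_fold_left:
  "1 \<le> i \<Longrightarrow> i \<le> n div 2 \<Longrightarrow> pair_fold n s i = (if s i then 2 * i - 1 else 2 * i)"
  by (simp add: pair_fold_def)

lemma pair_fold_right:
  "1 \<le> i \<Longrightarrow> i \<le> n div 2 \<Longrightarrow>
    pair_fold n s (n + 1 - i) = (if s i then 2 * i else 2 * i - 1)"
  by (auto simp: pair_fold_def)

text \<open>Surjectivity is the easy half: an element of the \<open>l\<close>-th pair is found at position \<open>l\<close> or
  at position \<open>n+1-l\<close>. Finiteness then gives bijectivity.\<close>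

lemma pair_fold_permutes: "pair_fold n s permutes {1..n}"
proof (rule bij_imp_permutes)
  have into: "pair_fold n s ` {1..n} \<subseteq> {1..n}"
    by (auto simp: pair_fold_def)
  have "x \<in> pair_fold n s ` {1..n}" if x: "x \<in> {1..n}" for x
  proof (cases "x \<le> 2 * (n div 2)")
    case True
    define l where "l = (x + 1) div 2"
    have l: "1 \<le> l" "l \<le> n div 2" "l \<in> {1..n}" "n + 1 - l \<in> {1..n}"
      and xl: "x = 2 * l - 1 \<or> x = 2 * l"
      using x True unfolding l_def by auto
    show ?thesis
      using xl pair_fold_left[OF l(1,2), of s] pair_fold_right[OF l(1,2), of s] l(3,4)
      by (metis image_eqI)
  next
    case False
    then have "x = n" "pair_fold n s (n div 2 + 1) = n" "n div 2 + 1 \<in> {1..n}"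
      using x by (auto simp: pair_fold_def)
    then show ?thesis by (metis image_eqI)
  qed
  with into have surj: "pair_fold n s ` {1..n} = {1..n}" by blast
  then show "bij_betw (pair_fold n s) {1..n} {1..n}"
    by (simp add: bij_betw_def eq_card_imp_inj_on)
qed (auto simp: pair_fold_def)

section \<open>Partial sums of a folded matrix\<close>

lemma sum_consecutive_pairs:
  fixes f :: "nat \<Rightarrow> 'a::comm_monoid_add"
  shows "(\<Sum>i=1..m. f (2 * i - 1) + f (2 * i)) = (\<Sum>i=1..2 * m. f i)"
  by (induction m) (auto simp: add.assoc)

lemma sum_last_reflect:
  fixes f :: "nat \<Rightarrow> 'a::comm_monoid_add"
  assumes "m \<le> n"
  shows "(\<Sum>i=m+1..n. f i) = (\<Sum>i=1..n - m. f (n + 1 - i))"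
  by (rule sum.reindex_bij_witness[of _ "\<lambda>i. n + 1 - i" "\<lambda>i. n + 1 - i"]) (use assms in auto)

definition half_differences ::
  "nat \<Rightarrow> nat \<Rightarrow> (nat \<Rightarrow> nat \<Rightarrow> 'a::real_vector) \<Rightarrow> (nat \<Rightarrow> nat \<Rightarrow> 'a)" where
  "half_differences k n C = (\<lambda>j\<in>{1..k}. \<lambda>i\<in>{1..n}.
     if i \<le> n div 2 then (1/2) *\<^sub>R (C j (2 * i - 1) - C j (2 * i)) else 0)"

definition fold_matrix ::
  "nat \<Rightarrow> nat \<Rightarrow> (nat \<Rightarrow> nat \<Rightarrow> real) \<Rightarrow> (nat \<Rightarrow> nat \<Rightarrow> 'a) \<Rightarrow> (nat \<Rightarrow> nat \<Rightarrow> 'a)" where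
  "fold_matrix k n \<epsilon> C =
    (\<lambda>j\<in>{1..k}. \<lambda>i\<in>{1..n}. C j (pair_fold n (\<lambda>i. \<epsilon> j i = 1) i))"

lemma matrices_entry:
  assumes "A \<in> matrices k n S" "j \<in> {1..k}" "i \<in> {1..n}"
  shows "A j i \<in> S"
  using assms unfolding matrices_def by (meson PiE_mem)

lemma half_differences_in_matrices:
  assumes K: "symmetric_convex_body K" and C: "\<And>j i. j \<in> {1..k} \<Longrightarrow> i \<in> {1..n} \<Longrightarrow> C j i \<in> K"
  shows "half_differences k n C \<in> matrices k n K"
  unfolding half_differences_def matrices_def
proof (intro PiE_I)
  fix j i assume j: "j \<in> {1..k}" and i: "i \<in> {1..n}"
  have "(1/2) *\<^sub>R (C j (2 * i - 1) - C j (2 * i)) \<in> K" if "i \<le> n div 2"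
  proof -
    have "2 * i - 1 \<in> {1..n}" "2 * i \<in> {1..n}"
      using i that unfolding atLeastAtMost_iff by linarith+
    then show ?thesis using C[OF j] by (intro symmetric_convex_body_half_diff[OF K])
  qed
  then show "(\<lambda>j\<in>{1..k}. \<lambda>i\<in>{1..n}.
      if i \<le> n div 2 then (1/2) *\<^sub>R (C j (2 * i - 1) - C j (2 * i)) else 0) j i \<in> K"
    using i j symmetric_convex_body_zero[OF K] by simp
qed auto

lemma row_permuted_copies_fold_matrix:
  assumes "C \<in> row_permuted_copies k n A"
  shows "fold_matrix k n \<epsilon> C \<in> row_permuted_copies k n A"
  unfolding row_permuted_copies_def
proof (intro CollectI conjI ballI)
  show "fold_matrix k n \<epsilon> C \<in> matrices k n UNIV"
    by (auto simp: fold_matrix_def matrices_def)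
next
  fix j assume j: "j \<in> {1..k}"
  with assms obtain p where p: "p permutes {1..n}" "\<forall>i\<in>{1..n}. C j i = A j (p i)"
    unfolding row_permuted_copies_def by blast
  let ?q = "pair_fold n (\<lambda>i. \<epsilon> j i = 1)"
  have "p \<circ> ?q permutes {1..n}"
    by (intro permutes_compose pair_fold_permutes p(1))
  moreover have "\<forall>i\<in>{1..n}. fold_matrix k n \<epsilon> C j i = A j ((p \<circ> ?q) i)"
    using p(2) j permutes_in_image[OF pair_fold_permutes] by (auto simp: fold_matrix_def)
  ultimately show "\<exists>p. p permutes {1..n} \<and> (\<forall>i\<in>{1..n}. fold_matrix k n \<epsilon> C j i = A j (p i))"
    by blast
qed

lemma column_sum_row_permuted_copy:
  assumes "C \<in> row_permuted_copies k n A"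
  shows "column_sum k n C = column_sum k n A"
  unfolding column_sum_def
proof (rule sum.cong[OF refl])
  fix j assume "j \<in> {1..k}"
  with assms obtain p where p: "p permutes {1..n}" "\<forall>i\<in>{1..n}. C j i = A j (p i)"
    unfolding row_permuted_copies_def by blast
  have "(\<Sum>i=1..n. C j i) = (\<Sum>i=1..n. A j (p i))" using p(2) by auto
  also have "\<dots> = (\<Sum>i=1..n. A j i)" using sum.permute[OF p(1), of "A j"] by (simp add: o_def)
  finally show "(\<Sum>i=1..n. C j i) = (\<Sum>i=1..n. A j i)" .
qed

text \<open>Of two vectors \<open>x\<close> and \<open>y\<close>, the selected one is \<open>(x + y)/2 \<plusminus> (x - y)/2\<close>, the sign being
  \<open>+\<close> exactly when \<open>x\<close> is selected; the rejected one has the opposite sign.\<close>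

lemma fold_matrix_left:
  fixes C :: "nat \<Rightarrow> nat \<Rightarrow> 'a::real_vector"
  assumes \<epsilon>: "\<epsilon> \<in> matrices k n {-1, 1}" and j: "j \<in> {1..k}" and i: "1 \<le> i" "i \<le> n div 2"
  shows "fold_matrix k n \<epsilon> C j i =
    (1/2) *\<^sub>R (C j (2 * i - 1) + C j (2 * i)) + signed_matrix k n \<epsilon> (half_differences k n C) j i"
proof -
  have "i \<in> {1..n}" using i by auto
  moreover from this have "\<epsilon> j i \<in> {-1, 1}" using matrices_entry[OF \<epsilon> j] by simp
  moreover have "x = (1/2) *\<^sub>R (x + y) + (1/2) *\<^sub>R (x - y)" for x y :: 'a
    by (simp add: algebra_simps flip: scaleR_add_left)
  moreover have "y = (1/2) *\<^sub>R (x + y) - (1/2) *\<^sub>R (x - y)" for x y :: 'a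
    by (simp add: algebra_simps flip: scaleR_add_left)
  ultimately show ?thesis
    using i j by (auto simp: fold_matrix_def signed_matrix_def half_differences_def pair_fold_left)
qed

lemma fold_matrix_right:
  fixes C :: "nat \<Rightarrow> nat \<Rightarrow> 'a::real_vector"
  assumes \<epsilon>: "\<epsilon> \<in> matrices k n {-1, 1}" and j: "j \<in> {1..k}" and i: "1 \<le> i" "i \<le> n div 2"
  shows "fold_matrix k n \<epsilon> C j (n + 1 - i) =
    (1/2) *\<^sub>R (C j (2 * i - 1) + C j (2 * i)) - signed_matrix k n \<epsilon> (half_differences k n C) j i"
proof -
  have "i \<in> {1..n}" "n + 1 - i \<in> {1..n}" using i by auto
  moreover from this have "\<epsilon> j i \<in> {-1, 1}" using matrices_entry[OF \<epsilon> j] by simp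
  moreover have "x = (1/2) *\<^sub>R (x + y) + (1/2) *\<^sub>R (x - y)" for x y :: 'a
    by (simp add: algebra_simps flip: scaleR_add_left)
  moreover have "y = (1/2) *\<^sub>R (x + y) - (1/2) *\<^sub>R (x - y)" for x y :: 'a
    by (simp add: algebra_simps flip: scaleR_add_left)
  ultimately show ?thesis
    using i j pair_fold_right[OF i]
    by (auto simp: fold_matrix_def signed_matrix_def half_differences_def simp del: Nat.diff_add_assoc2)
qed

lemma half_column_sum_double:
  "(1/2) *\<^sub>R column_sum k (2 * m) C =
    (\<Sum>j=1..k. \<Sum>i=1..m. (1/2) *\<^sub>R (C j (2 * i - 1) + C j (2 * i)))"
  unfolding column_sum_def scaleR_sum_right sum_consecutive_pairs[symmetric] scaleR_add_right ..

lemma column_sum_fold_first: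
  fixes C :: "nat \<Rightarrow> nat \<Rightarrow> 'a::real_vector"
  assumes \<epsilon>: "\<epsilon> \<in> matrices k n {-1, 1}" and m: "m \<le> n div 2"
  shows "column_sum k m (fold_matrix k n \<epsilon> C) =
    (1/2) *\<^sub>R column_sum k (2 * m) C + column_sum k m (signed_matrix k n \<epsilon> (half_differences k n C))"
  unfolding half_column_sum_double unfolding column_sum_def sum.distrib[symmetric]
  using m by (intro sum.cong refl fold_matrix_left[OF \<epsilon>]) auto

lemma column_sum_fold_last:
  fixes C :: "nat \<Rightarrow> nat \<Rightarrow> 'a::real_vector"
  assumes \<epsilon>: "\<epsilon> \<in> matrices k n {-1, 1}" and m: "m \<le> n div 2"
  shows "(\<Sum>j=1..k. \<Sum>i=1..m. fold_matrix k n \<epsilon> C j (n + 1 - i)) =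
    (1/2) *\<^sub>R column_sum k (2 * m) C - column_sum k m (signed_matrix k n \<epsilon> (half_differences k n C))"
  unfolding half_column_sum_double unfolding column_sum_def sum_subtractf[symmetric]
  using m by (intro sum.cong refl fold_matrix_right[OF \<epsilon>]) auto

lemma column_sum_split_last:
  fixes A :: "nat \<Rightarrow> nat \<Rightarrow> 'a::real_vector"
  assumes "m \<le> n"
  shows "column_sum k n A = column_sum k m A + (\<Sum>j=1..k. \<Sum>i=1..n - m. A j (n + 1 - i))"
proof -
  have "(\<Sum>i=1..n. f i) = (\<Sum>i=1..m. f i) + (\<Sum>i=m+1..n. f i)" for f :: "nat \<Rightarrow> 'a"
    using sum.ub_add_nat[of 1 m f "n - m"] assms by simp
  then show ?thesis
    by (simp add: column_sum_def sum_last_reflect[OF assms] flip: sum.distrib del: One_nat_def)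
qed

text \<open>In the left half the bound is read off directly; beyond
  the middle the zero total turns an initial sum into minus a sum over at most \<open>n div 2\<close> final
  columns.\<close>

lemma column_sum_fold_bound:
  fixes C :: "nat \<Rightarrow> nat \<Rightarrow> 'a::euclidean_space"
  assumes K: "symmetric_convex_body K" and n: "1 \<le> n" and \<epsilon>: "\<epsilon> \<in> matrices k n {-1, 1}"
    and zero: "column_sum k n (fold_matrix k n \<epsilon> C) = 0" and m: "m \<le> n"
  shows "body_norm K (column_sum k m (fold_matrix k n \<epsilon> C)) \<le>
    max_partial_norm k n K C / 2 +
    max_partial_norm k n K (signed_matrix k n \<epsilon> (half_differences k n C))"
proof -
  let ?S = "signed_matrix k n \<epsilon> (half_differences k n C)"
  have bound: "body_norm K (column_sum k (2 * l) C) / 2 + body_norm K (column_sum k l ?S) \<le>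
      max_partial_norm k n K C / 2 + max_partial_norm k n K ?S" if "l \<le> n div 2" for l
    using that body_norm_column_sum_le[OF K n, of "2 * l" k C]
      body_norm_column_sum_le[OF K n, of l k ?S] by linarith
  show ?thesis
  proof (cases "m \<le> n div 2")
    case True
    have "body_norm K (column_sum k m (fold_matrix k n \<epsilon> C)) \<le>
        body_norm K (column_sum k (2 * m) C) / 2 + body_norm K (column_sum k m ?S)"
      unfolding column_sum_fold_first[OF \<epsilon> True] by (rule body_norm_half_plus_le[OF K])
    with bound[OF True] show ?thesis by linarith
  next
    case False
    define l where "l = n - m"
    have l: "l \<le> n div 2" using False unfolding l_def by linarith
    have "column_sum k m (fold_matrix k n \<epsilon> C) =
        - (\<Sum>j=1..k. \<Sum>i=1..l. fold_matrix k n \<epsilon> C j (n + 1 - i))"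
      using column_sum_split_last[OF m, of k "fold_matrix k n \<epsilon> C"] zero
      unfolding l_def by (simp add: eq_neg_iff_add_eq_0)
    also have "\<dots> = - ((1/2) *\<^sub>R column_sum k (2 * l) C + (- column_sum k l ?S))"
      unfolding column_sum_fold_last[OF \<epsilon> l] by simp
    finally have "body_norm K (column_sum k m (fold_matrix k n \<epsilon> C)) =
        body_norm K ((1/2) *\<^sub>R column_sum k (2 * l) C + (- column_sum k l ?S))"
      by (simp only: body_norm_minus[OF K])
    also have "\<dots> \<le> body_norm K (column_sum k (2 * l) C) / 2 + body_norm K (column_sum k l ?S)"
      using body_norm_half_plus_le[OF K, of "column_sum k (2 * l) C" "- column_sum k l ?S"]
      by (simp only: body_norm_minus[OF K])
    finally show ?thesis using bound[OF l] by linarith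
  qed
qed

section \<open>Comparison of the two constants\<close>

lemma U_matrix_le:
  assumes "C \<in> row_permuted_copies k n A"
  shows "U_matrix k n K A \<le> max_partial_norm k n K C"
  unfolding U_matrix_def using assms by (intro Min_le finite_imageI finite_row_permuted_copies) auto

lemma U_matrix_attained:
  obtains C where "C \<in> row_permuted_copies k n A" "U_matrix k n K A = max_partial_norm k n K C"
proof -
  have "U_matrix k n K A \<in> max_partial_norm k n K ` row_permuted_copies k n A"
    unfolding U_matrix_def
    by (intro Min_in finite_imageI) (simp_all add: finite_row_permuted_copies)
  then show thesis using that by blast
qed

lemma V_matrix_attained:
  obtains \<epsilon> where "\<epsilon> \<in> matrices k n {-1, 1}"
    "V_matrix k n K B = max_partial_norm k n K (signed_matrix k n \<epsilon> B)"
proof -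
  have "V_matrix k n K B \<in>
      (\<lambda>\<epsilon>. max_partial_norm k n K (signed_matrix k n \<epsilon> B)) ` matrices k n {-1, 1}"
    unfolding V_matrix_def
    by (intro Min_in finite_imageI finite_matrices) (simp_all add: matrices_def PiE_eq_empty_iff)
  then show thesis using that by blast
qed

lemma row_permuted_copies_entry:
  assumes "C \<in> row_permuted_copies k n A" "A \<in> matrices k n S" "j \<in> {1..k}" "i \<in> {1..n}"
  shows "C j i \<in> S"
proof -
  obtain p where p: "p permutes {1..n}" "C j i = A j (p i)"
    using assms(1,3,4) unfolding row_permuted_copies_def by blast
  then have "p i \<in> {1..n}" using assms(4) permutes_in_image by metis
  then show ?thesis using matrices_entry[OF assms(2,3)] p(2) by simp
qed

lemma U_matrix_le_V_body:
  fixes A :: "nat \<Rightarrow> nat \<Rightarrow> 'a::euclidean_space"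
  assumes K: "symmetric_convex_body K" and n: "1 \<le> n"
    and A: "A \<in> matrices k n K" and zero: "column_sum k n A = 0"
  shows "U_matrix k n K A \<le> 2 * V_body k n K"
proof -
  obtain C where C: "C \<in> row_permuted_copies k n A"
    and UC: "U_matrix k n K A = max_partial_norm k n K C"
    by (rule U_matrix_attained)
  define B where "B = half_differences k n C"
  have "B \<in> matrices k n K"
    unfolding B_def
    by (rule half_differences_in_matrices[OF K row_permuted_copies_entry[OF C A]])
  then have "V_matrix k n K B \<le> V_body k n K"
    using V_body_attained[OF K n] by blast
  moreover obtain \<epsilon> where \<epsilon>: "\<epsilon> \<in> matrices k n {-1, 1}"
    and VB: "V_matrix k n K B = max_partial_norm k n K (signed_matrix k n \<epsilon> B)"
    by (rule V_matrix_attained)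
  moreover define D where "D = fold_matrix k n \<epsilon> C"
  have D: "D \<in> row_permuted_copies k n A"
    unfolding D_def using C by (rule row_permuted_copies_fold_matrix)
  then have "column_sum k n D = 0"
    using zero column_sum_row_permuted_copy by metis
  then have "body_norm K (column_sum k m D) \<le>
      max_partial_norm k n K C / 2 + max_partial_norm k n K (signed_matrix k n \<epsilon> B)"
    if "m \<in> {1..n}" for m
    unfolding D_def B_def using that by (intro column_sum_fold_bound[OF K n \<epsilon>]) auto
  then have "max_partial_norm k n K D \<le>
      max_partial_norm k n K C / 2 + max_partial_norm k n K (signed_matrix k n \<epsilon> B)"
    unfolding max_partial_norm_def[of k n K D] using n by (intro Max.boundedI) auto
  moreover have "U_matrix k n K A \<le> max_partial_norm k n K D"
    using D by (rule U_matrix_le)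
  ultimately show ?thesis using UC by linarith
qed

theorem theorem2p2:
  fixes K :: "(real ^ 'd) set" and k n :: nat
  assumes "symmetric_convex_body K" and "k \<ge> 1" and "n \<ge> 1"
  shows "U_body k n K \<le> 2 * V_body k n K"
proof -
  obtain A where "A \<in> matrices k n K" "column_sum k n A = 0" "U_matrix k n K A = U_body k n K"
    using U_body_attained[OF assms(1,3)] by blast
  then show ?thesis
    using U_matrix_le_V_body[OF assms(1,3)] by metis
qed

end
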